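(* Let $p$ be a prime number and let $P$ be a finite abelian $p$-group of type $e$ (where $e \in E(n)$, $n\geq 1$). Let $\varphi \in \mathrm{Aut}(P)$. Then $$\Pi(\varphi) \leq p^{\Sigma(e)}.$$
   Context: For an integer $n \geq 1$, $E(n)$ is the set of $e=(e_1,\ldots,e_n)\in\mathbb{Z}^n$ with $1 \leq e_1 \leq e_2 \leq \cdots \leq e_n$. For a prime $p$, a finite abelian $p$-group is of type $e \in E(n)$ if it is isomorphic to $\bigoplus_{i=1}^n \mathbb{Z}/p^{e_i}\mathbb{Z}$. Put $\Sigma(e) = \sum_{i=1}^n e_i$. $\Pi$: for a finite abelian $p$-group $P$ (written additively) and $i \in \mathbb{Z}$ coprime with $p$, let $\mu_i \in \mathrm{Aut}(P)$ be given by $\mu_i(x) = ix$. For an automorphism $\psi$, $\mathrm{Fix}(\psi)$ is its set of fixed points. For $\varphi \in \mathrm{Aut}(P)$ put $\Pi(\varphi) = \prod_{i=1}^{p-1} |\mathrm{Fix}(\mu_i \circ \varphi)|$. *)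

theory Defs
  imports "HOL-Algebra.Algebra" "HOL-Computational_Algebra.Primes"
begin

text \<open>
  Groups are written multiplicatively, as everywhere in HOL-Algebra: the additive multiple
  $ix$ of the source is \<open>x [^] i\<close>.
\<close>

text \<open>
  The set $E(n)$. A tuple is a list of length \<open>n\<close>, so that $e_i$ is \<open>e ! (i - 1)\<close>. The entries
  are natural numbers, since all integers occurring in elements of $E(n)$ are positive.
\<close>

definition E :: "nat \<Rightarrow> nat list set" where
  "E n = {e. length e = n \<and> (\<forall>x\<in>set e. 1 \<le> x) \<and> sorted e}"

definition Sigma_sum :: "nat list \<Rightarrow> nat" where
  "Sigma_sum e = (\<Sum>i<length e. e ! i)"

definition finite_abelian_p_group :: "nat \<Rightarrow> ('a, 'b) monoid_scheme \<Rightarrow> bool" where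
  "finite_abelian_p_group p P \<longleftrightarrow>
     comm_group P \<and> finite (carrier P) \<and> (\<exists>k. order P = p ^ k)"

definition of_type :: "nat \<Rightarrow> nat list \<Rightarrow> ('a, 'b) monoid_scheme \<Rightarrow> bool" where
  "of_type p e P \<longleftrightarrow> P \<cong> sum_group {..<length e} (\<lambda>i. integer_mod_group (p ^ (e ! i)))"

text \<open>
  Automorphisms are the elements of \<^term>\<open>auto P\<close>, which are extensional functions. Hence \<open>\<mu>\<close>
  is restricted to the carrier, and composition is \<^term>\<open>compose (carrier P)\<close>, which is the
  multiplication of \<^term>\<open>AutoGroup P\<close>.
\<close>

definition mu :: "('a, 'b) monoid_scheme \<Rightarrow> int \<Rightarrow> 'a \<Rightarrow> 'a" where
  "mu P i = (\<lambda>x\<in>carrier P. x [^]\<^bsub>P\<^esub> i)"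

definition Fix :: "('a, 'b) monoid_scheme \<Rightarrow> ('a \<Rightarrow> 'a) \<Rightarrow> 'a set" where
  "Fix P \<psi> = {x \<in> carrier P. \<psi> x = x}"

definition Pi_fix :: "nat \<Rightarrow> ('a, 'b) monoid_scheme \<Rightarrow> ('a \<Rightarrow> 'a) \<Rightarrow> nat" where
  "Pi_fix p P \<phi> = (\<Prod>i = 1..p - 1. card (Fix P (compose (carrier P) (mu P (int i)) \<phi>)))"

lemma mu_in_auto:
  assumes "finite_abelian_p_group p P" "coprime i (int p)"
  shows "mu P i \<in> auto P"
proof -
  interpret comm_group P
    using assms(1) by (simp add: finite_abelian_p_group_def)
  have fin: "finite (carrier P)"
    using assms(1) by (simp add: finite_abelian_p_group_def)
  obtain k where k: "order P = p ^ k"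
    using assms(1) by (auto simp: finite_abelian_p_group_def)
  have cop: "coprime i (int (order P))"
    using assms(2) by (simp add: k)
  have hom: "mu P i \<in> hom P P"
    by (auto simp: hom_def mu_def int_pow_mult_distrib m_comm)
  have ker: "x = \<one>\<^bsub>P\<^esub>" if x: "x \<in> carrier P" "x [^]\<^bsub>P\<^esub> i = \<one>\<^bsub>P\<^esub>" for x
  proof -
    have "int (ord x) dvd i"
      using x by (simp add: int_pow_eq_id)
    moreover have "int (ord x) dvd int (order P)"
      using x(1) by (simp add: ord_dvd_group_order)
    ultimately have "int (ord x) dvd 1"
      using cop by (metis coprime_common_divisor)
    then show ?thesis
      using x(1) ord_eq_1 by simp
  qed
  interpret group_hom P P "mu P i"
    by unfold_locales (rule hom)
  have inj: "inj_on (mu P i) (carrier P)"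
    by (rule inj_on_one_iff[THEN iffD2]) (auto simp: mu_def intro: ker)
  have "mu P i ` carrier P = carrier P"
    using inj fin by (intro endo_inj_surj) (auto simp: mu_def)
  then show ?thesis
    using hom inj by (auto simp: auto_def Bij_def bij_betw_def mu_def)
qed

lemma compose_eq_mult_AutoGroup:
  assumes "f \<in> auto P" "g \<in> auto P"
  shows "compose (carrier P) f g = f \<otimes>\<^bsub>AutoGroup P\<^esub> g"
  using assms by (simp add: auto_def AutoGroup_def BijGroup_def)

end

theory Submission
  imports Defs
begin

text \<open>
  Put \<open>\<phi>\<^sub>i = \<mu>\<^sub>i \<circ> \<phi>\<close>. The fixed points of \<open>\<phi>\<^sub>i\<close> form an eigenspace of \<open>\<phi>\<close> with eigenvalue
  \<open>1 / i\<close>, and for distinct \<open>i\<close> and \<open>j\<close> in the range from \<open>1\<close> to \<open>p - 1\<close> the difference of the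
  eigenvalues is a unit modulo \<open>p\<close>. As for a linear map with distinct eigenvalues, the sum of the
  eigenspaces is therefore direct, so the product of their orders is at most the order of \<open>P\<close>,
  which is \<open>p\<close> to the power \<open>\<Sigma>(e)\<close>.

  The argument for directness only uses that the \<open>\<phi>\<^sub>i\<close> are endomorphisms which commute pairwise
  and that no two of them have a common fixed point other than the identity; this is the content
  of \<open>inj_on_finprod_Fix\<close>, which \<open>prod_card_Fix_le_order\<close> turns into the bound on orders. That these hypotheses hold for the \<open>\<phi>\<^sub>i\<close> is where \<open>p\<close> enters: a common
  fixed point \<open>x\<close> of \<open>\<phi>\<^sub>i\<close> and \<open>\<phi>\<^sub>j\<close> satisfies \<open>(i - j) \<phi>(x) = 0\<close>, and \<open>i - j\<close> is prime
  to the order of \<open>P\<close>.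
\<close>

lemma (in comm_group) hom_finprod_comm_group:
  assumes "g \<in> hom G G" "finite I" "\<And>i. i \<in> I \<Longrightarrow> x i \<in> carrier G"
  shows "g (finprod G x I) = (\<Otimes>i\<in>I. g (x i))"
proof -
  interpret group_hom G G g
    using assms(1) by unfold_locales
  show ?thesis
    using assms(2,3) by (induction I) (auto simp: Pi_iff)
qed

lemma (in comm_group) hom_displacement:
  assumes "f \<in> hom G G"
  shows "(\<lambda>x. f x \<otimes> inv x) \<in> hom G G"
proof -
  interpret group_hom G G f
    using assms by unfold_locales
  show ?thesis
    by (auto simp: hom_def inv_mult m_ac)
qed

text \<open>
  The displacement \<open>x \<mapsto> f j x \<otimes> inv x\<close> is an endomorphism that kills the fixed points of \<open>f j\<close>.
  On the fixed points of any other \<open>f i\<close> it is injective, because a point of its kernel is fixed by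
  both \<open>f i\<close> and \<open>f j\<close>, and it preserves them, because \<open>f i\<close> and \<open>f j\<close> commute. Applied to an
  equation between two products, it thus removes the factor with index \<open>j\<close> and lets induction
  compare the others.
\<close>

lemma (in comm_group) inj_on_finprod_Fix:
  assumes "finite I"
    and hom: "\<And>i. i \<in> I \<Longrightarrow> f i \<in> hom G G"
    and commute: "\<And>i j x. i \<in> I \<Longrightarrow> j \<in> I \<Longrightarrow> x \<in> carrier G \<Longrightarrow> f i (f j x) = f j (f i x)"
    and disjoint: "\<And>i j. i \<in> I \<Longrightarrow> j \<in> I \<Longrightarrow> i \<noteq> j \<Longrightarrow> Fix G (f i) \<inter> Fix G (f j) \<subseteq> {\<one>}"
  shows "inj_on (\<lambda>x. finprod G x I) (\<Pi>\<^sub>E i\<in>I. Fix G (f i))"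
proof -
  have "\<forall>i\<in>J. x i = y i"
    if "finite J" "J \<subseteq> I" "x \<in> (\<Pi> i\<in>J. Fix G (f i))" "y \<in> (\<Pi> i\<in>J. Fix G (f i))"
      "finprod G x J = finprod G y J" for J x y
    using that
  proof (induction J arbitrary: x y rule: finite_induct)
    case empty
    then show ?case by simp
  next
    case (insert j J)
    define g where "g z = f j z \<otimes> inv z" for z
    have jI: "j \<in> I" and JI: "J \<subseteq> I"
      using insert.prems(1) by auto
    have xj: "x j \<in> Fix G (f j)" and yj: "y j \<in> Fix G (f j)"
      using insert.prems by auto
    have g_hom: "g \<in> hom G G"
      using hom_displacement[OF hom[OF jI]] by (simp add: g_def[abs_def])
    then interpret g: group_hom G G g
      by unfold_locales
    have g_j: "g z = \<one>" if "z \<in> Fix G (f j)" for z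
      using that by (simp add: g_def Fix_def)
    have g_Fix: "g z \<in> Fix G (f i)" if "i \<in> J" "z \<in> Fix G (f i)" for i z
    proof -
      have z: "z \<in> carrier G" "f i z = z"
        using that(2) by (auto simp: Fix_def)
      have iI: "i \<in> I"
        using that(1) JI by auto
      interpret fi: group_hom G G "f i"
        using hom[OF iI] by unfold_locales
      interpret fj: group_hom G G "f j"
        using hom[OF jI] by unfold_locales
      have "f i (g z) = g z"
        using z commute[OF iI jI z(1)] by (simp add: g_def)
      then show ?thesis
        using z by (simp add: Fix_def)
    qed
    have g_inj: "z = w" if "i \<in> J" "z \<in> Fix G (f i)" "w \<in> Fix G (f i)" "g z = g w" for i z w
    proof -
      have zw: "z \<in> carrier G" "f i z = z" "w \<in> carrier G" "f i w = w"
        using that(2,3) by (auto simp: Fix_def)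
      have iI: "i \<in> I" and ij: "i \<noteq> j"
        using that(1) JI insert.hyps by auto
      interpret fi: group_hom G G "f i"
        using hom[OF iI] by unfold_locales
      interpret fj: group_hom G G "f j"
        using hom[OF jI] by unfold_locales
      have "g (z \<otimes> inv w) = \<one>"
        using that(4) zw by simp
      then have "f j (z \<otimes> inv w) = z \<otimes> inv w"
        using zw inv_equality[of "f j (z \<otimes> inv w)" "inv (z \<otimes> inv w)"]
        by (simp add: g_def del: fj.hom_mult)
      then have "z \<otimes> inv w \<in> Fix G (f i) \<inter> Fix G (f j)"
        using zw by (simp add: Fix_def)
      then have "z \<otimes> inv w = \<one>"
        using disjoint[OF iI jI ij] by auto
      then show ?thesis
        using zw inv_equality[of z "inv w"] by simp
    qed
    have carr: "x i \<in> carrier G" "y i \<in> carrier G" if "i \<in> insert j J" for i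
      using that insert.prems by (auto simp: Fix_def)
    have image: "g (finprod G z (insert j J)) = (\<Otimes>i\<in>J. g (z i))"
      if "z j \<in> Fix G (f j)" "\<And>i. i \<in> insert j J \<Longrightarrow> z i \<in> carrier G" for z
      using that insert.hyps hom_finprod_comm_group[OF g_hom insert.hyps(1), of z]
      by (simp add: Pi_iff g_j)
    have "(\<Otimes>i\<in>J. g (x i)) = (\<Otimes>i\<in>J. g (y i))"
      using image[of x] image[of y] xj yj carr insert.prems(4) by simp
    then have "\<forall>i\<in>J. g (x i) = g (y i)"
      using insert.prems(2,3) g_Fix by (intro insert.IH JI) (auto simp: Pi_iff)
    then have eq: "\<forall>i\<in>J. x i = y i"
      using insert.prems g_inj by (metis PiE Pi_mem insertI2)
    then have "finprod G x J = finprod G y J"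
      using carr by (intro finprod_cong') auto
    then have "x j = y j"
      using insert.prems(4) insert.hyps carr by (simp add: Pi_iff)
    then show ?case
      using eq by simp
  qed
  from this[OF assms(1) order.refl] have eq: "x i = y i"
    if "x \<in> (\<Pi>\<^sub>E i\<in>I. Fix G (f i))" "y \<in> (\<Pi>\<^sub>E i\<in>I. Fix G (f i))"
      "finprod G x I = finprod G y I" "i \<in> I" for x y i
    using that by (auto simp: PiE_def)
  show ?thesis
    by (intro inj_onI) (metis PiE_ext eq)
qed

lemma (in comm_group) prod_card_Fix_le_order:
  assumes "finite (carrier G)" "finite I"
    and "\<And>i. i \<in> I \<Longrightarrow> f i \<in> hom G G"
    and "\<And>i j x. i \<in> I \<Longrightarrow> j \<in> I \<Longrightarrow> x \<in> carrier G \<Longrightarrow> f i (f j x) = f j (f i x)"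
    and "\<And>i j. i \<in> I \<Longrightarrow> j \<in> I \<Longrightarrow> i \<noteq> j \<Longrightarrow> Fix G (f i) \<inter> Fix G (f j) \<subseteq> {\<one>}"
  shows "(\<Prod>i\<in>I. card (Fix G (f i))) \<le> order G"
proof -
  have "(\<Prod>i\<in>I. card (Fix G (f i))) = card (\<Pi>\<^sub>E i\<in>I. Fix G (f i))"
    using assms(2) by (simp add: card_PiE)
  also have "\<dots> \<le> card (carrier G)"
  proof (rule card_inj_on_le)
    show "inj_on (\<lambda>x. finprod G x I) (\<Pi>\<^sub>E i\<in>I. Fix G (f i))"
      using assms by (intro inj_on_finprod_Fix)
    show "(\<lambda>x. finprod G x I) ` (\<Pi>\<^sub>E i\<in>I. Fix G (f i)) \<subseteq> carrier G"
      by (auto intro!: finprod_closed simp: Fix_def)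
  qed (fact assms(1))
  finally show ?thesis
    by (simp add: order_def)
qed

lemma (in group) int_pow_eq_one_coprime_order:
  assumes "x \<in> carrier G" "x [^] (i::int) = \<one>" "coprime i (int (order G))"
  shows "x = \<one>"
proof -
  have "int (ord x) dvd i"
    using assms by (simp add: int_pow_eq_id)
  moreover have "int (ord x) dvd int (order G)"
    using assms(1) by (simp add: ord_dvd_group_order)
  ultimately have "int (ord x) dvd 1"
    using assms(3) by (metis coprime_common_divisor)
  then show ?thesis
    using assms(1) ord_eq_1 by simp
qed

lemma order_of_type:
  assumes "of_type p e P" "p > 0"
  shows "order P = p ^ Sigma_sum e"
proof -
  have "order P = card (carrier (sum_group {..<length e} (\<lambda>i. integer_mod_group (p ^ (e ! i)))))"
    using assms(1) by (simp add: of_type_def order_def iso_same_card)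
  also have "\<dots> = card (\<Pi>\<^sub>E i\<in>{..<length e}. {0..<int (p ^ (e ! i))})"
    using assms(2) by (simp add: carrier_sum_group carrier_integer_mod_group)
  also have "\<dots> = p ^ Sigma_sum e"
    by (simp add: card_PiE Sigma_sum_def power_sum nat_power_eq)
  finally show ?thesis .
qed

theorem proposition4p9:
  fixes p n :: nat and e :: "nat list" and P :: "('a, 'b) monoid_scheme" and \<phi> :: "'a \<Rightarrow> 'a"
  assumes "Factorial_Ring.prime p"
    and "n \<ge> 1"
    and "e \<in> E n"
    and "finite_abelian_p_group p P"
    and "of_type p e P"
    and "\<phi> \<in> auto P"
  shows "Pi_fix p P \<phi> \<le> p ^ Sigma_sum e"
proof -
  interpret comm_group P
    using assms(4) by (simp add: finite_abelian_p_group_def)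
  have hom: "\<phi> \<in> hom P P"
    using assms(6) by (simp add: auto_def)
  interpret phi: group_hom P P \<phi>
    using hom by unfold_locales
  have order: "order P = p ^ Sigma_sum e"
    using order_of_type[OF assms(5)] assms(1) by (simp add: prime_gt_0_nat)
  define f where "f i = compose (carrier P) (mu P (int i)) \<phi>" for i
  have f: "f i x = \<phi> x [^]\<^bsub>P\<^esub> int i" if "x \<in> carrier P" for i x
    using that by (simp add: f_def compose_def mu_def)
  \<comment> \<open>The maps \<open>f i\<close> commute because \<open>\<phi>\<close> commutes with taking powers.\<close>
  have phi_pow: "\<phi> (x [^]\<^bsub>P\<^esub> int i) = \<phi> x [^]\<^bsub>P\<^esub> int i" if "x \<in> carrier P" for i x
    using that by (simp add: phi.hom_int_pow)
  have "(\<Prod>i\<in>{1..p - 1}. card (Fix P (f i))) \<le> order P"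
  proof (rule prod_card_Fix_le_order)
    show "finite (carrier P)"
      using assms(4) by (simp add: finite_abelian_p_group_def)
    show "f i \<in> hom P P" for i
      by (auto simp: hom_def f int_pow_mult_distrib m_comm)
    show "f i (f j x) = f j (f i x)" if "x \<in> carrier P" for i j x
      using that by (simp add: f phi_pow int_pow_pow mult.commute)
  next
    fix i j
    assume ij: "i \<in> {1..p - 1}" "j \<in> {1..p - 1}" "i \<noteq> j"
    \<comment> \<open>The difference is nonzero and its absolute value is less than \<open>p\<close>.\<close>
    have "\<not> int p dvd int i - int j"
      using ij zdvd_imp_le[of "int p" "int i - int j"] zdvd_imp_le[of "int p" "int j - int i"]
        dvd_minus_iff[of "int p" "int i - int j"] by force
    then have "coprime (int i - int j) (int p)"
      using assms(1) by (metis coprime_commute prime_imp_coprime prime_nat_int_transfer)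
    then have cop: "coprime (int i - int j) (int (order P))"
      by (simp add: order)
    show "Fix P (f i) \<inter> Fix P (f j) \<subseteq> {\<one>\<^bsub>P\<^esub>}"
    proof
      fix x
      assume "x \<in> Fix P (f i) \<inter> Fix P (f j)"
      then have x: "x \<in> carrier P" "\<phi> x [^]\<^bsub>P\<^esub> int i = x" "\<phi> x [^]\<^bsub>P\<^esub> int j = x"
        by (auto simp: Fix_def f)
      then have "\<phi> x [^]\<^bsub>P\<^esub> (int i - int j) = \<one>\<^bsub>P\<^esub>"
        by (metis int_pow_diff phi.hom_closed r_inv)
      then have "\<phi> x = \<one>\<^bsub>P\<^esub>"
        using int_pow_eq_one_coprime_order[OF _ _ cop] x(1) by simp
      then show "x \<in> {\<one>\<^bsub>P\<^esub>}"
        using x(2) by (simp add: int_pow_one)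
    qed
  qed simp
  then show ?thesis
    by (simp add: Pi_fix_def f_def order)
qed

end
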